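(* Let $\alpha>0$, let $\Omega\subset\mathbb{R}^d$ be open and convex, and let $\varphi:\Omega\to\mathbb{R}$ be $\alpha$-exponentially convex and satisfy the regularity conditions of the context. Let $c^{(\alpha)}(x,y)=\frac1\alpha\log(1+\alpha x\cdot y)$. Then the map $$\xi\mapsto\eta=D^{(\alpha)}\varphi(\xi)=\frac{D\varphi(\xi)}{1-\alpha D\varphi(\xi)\cdot\xi}$$ is a diffeomorphism from $\Omega$ onto its range $\Omega'$, and the $(-\alpha)$-conjugate $\psi(\eta)=c^{(\alpha)}(\xi,\eta)-\varphi(\xi)$, $\xi=(D^{(\alpha)}\varphi)^{-1}(\eta)$, is locally $\alpha$-exponentially convex on $\Omega'$. The functions $\varphi$ and $\psi$ are related by $$\varphi(\xi)=\max_{\eta'\in\Omega'}\big(c^{(\alpha)}(\xi,\eta')-\psi(\eta')\big),\qquad\psi(\eta)=\max_{\xi'\in\Omega}\big(c^{(\alpha)}(\xi',\eta)-\varphi(\xi')\big)$$ for $\xi\in\Omega$, $\eta\in\Omega'$. The $L^{(-\alpha)}$-divergence of $\varphi$ admits the self-dual representation $$\mathbf{D}^{(-\alpha)}[\xi:\xi']=\varphi(\xi)+\psi(\eta')-c^{(\alpha)}(\xi,\eta'),\qquad\xi,\xi'\in\Omega,\ \eta'=D^{(\alpha)}\varphi(\xi').$$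
   Context: $D$, $D^2$ are the Euclidean gradient and Hessian. $\varphi$ is $\alpha$-exponentially convex if $e^{\alpha\varphi}$ is convex. Regularity conditions: $\varphi$ is smooth, $D^2\varphi+\alpha(D\varphi)(D\varphi)^\top$ is strictly positive definite on $\Omega$, $0\in\Omega$, and $1+\alpha D\varphi(\xi')\cdot(\xi-\xi')>0$ for all $\xi,\xi'\in\Omega$. $L^{(-\alpha)}$-divergence: $\mathbf{D}^{(-\alpha)}[\xi:\xi']=(\varphi(\xi)-\varphi(\xi'))-\frac1\alpha\log\big(1+\alpha D\varphi(\xi')\cdot(\xi-\xi')\big)$. "Locally $\alpha$-exponentially convex on $\Omega'$" means that $D^2\psi+\alpha(D\psi)(D\psi)^\top$ is strictly positive definite on $\Omega'$. *)

theory Defs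
  imports "HOL-Analysis.Analysis"
begin

text \<open>
  Functions on a set are total functions whose values outside the set are irrelevant. All sets on
  which differentiability is considered below are open, so that derivatives are taken at
  \<^term>\<open>at x\<close> without restriction.
\<close>

primrec continuously_differentiable_on ::
    "nat \<Rightarrow> ('a::euclidean_space \<Rightarrow> 'b::euclidean_space) \<Rightarrow> 'a set \<Rightarrow> bool" where
  "continuously_differentiable_on 0 f S \<longleftrightarrow> continuous_on S f"
| "continuously_differentiable_on (Suc k) f S \<longleftrightarrow>
     (\<forall>x\<in>S. f differentiable at x) \<and>
     (\<forall>v. continuously_differentiable_on k (\<lambda>x. frechet_derivative f (at x) v) S)"

definition smooth_on ::
    "('a::euclidean_space \<Rightarrow> 'b::euclidean_space) \<Rightarrow> 'a set \<Rightarrow> bool" where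
  "smooth_on f S \<longleftrightarrow> (\<forall>k. continuously_differentiable_on k f S)"

definition diffeomorphism ::
    "'a::euclidean_space set \<Rightarrow> 'b::euclidean_space set \<Rightarrow> ('a \<Rightarrow> 'b) \<Rightarrow> ('b \<Rightarrow> 'a) \<Rightarrow> bool" where
  "diffeomorphism S T f g \<longleftrightarrow>
     open S \<and> open T \<and> homeomorphism S T f g \<and> smooth_on f S \<and> smooth_on g T"

definition grad :: "(real^'n \<Rightarrow> real) \<Rightarrow> real^'n \<Rightarrow> real^'n" where
  "grad f x = (THE D. GDERIV f x :> D)"

definition hessian :: "(real^'n \<Rightarrow> real) \<Rightarrow> real^'n \<Rightarrow> real^'n^'n" where
  "hessian f x = jacobian (grad f) (at x)"

definition pos_definite :: "real^'n^'n \<Rightarrow> bool" where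
  "pos_definite A \<longleftrightarrow> transpose A = A \<and> (\<forall>v. v \<noteq> 0 \<longrightarrow> v \<bullet> (A *v v) > 0)"

definition exp_convex_on :: "real \<Rightarrow> (real^'n) set \<Rightarrow> (real^'n \<Rightarrow> real) \<Rightarrow> bool" where
  "exp_convex_on \<alpha> S f \<longleftrightarrow> convex_on S (\<lambda>x. exp (\<alpha> * f x))"

definition exp_hessian :: "real \<Rightarrow> (real^'n \<Rightarrow> real) \<Rightarrow> real^'n \<Rightarrow> real^'n^'n" where
  "exp_hessian \<alpha> f x =
     hessian f x + \<alpha> *\<^sub>R ((columnvector (grad f x) :: real^1^'n) ** rowvector (grad f x))"

text \<open>
  The requirement of class \<open>C\<^sup>2\<close> makes explicit that the gradient and the Hessian exist; otherwise
  \<^const>\<open>grad\<close> and \<^const>\<open>hessian\<close> would have unspecified values.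
\<close>

definition locally_exp_convex_on :: "real \<Rightarrow> (real^'n) set \<Rightarrow> (real^'n \<Rightarrow> real) \<Rightarrow> bool" where
  "locally_exp_convex_on \<alpha> S f \<longleftrightarrow>
     continuously_differentiable_on 2 f S \<and> (\<forall>x\<in>S. pos_definite (exp_hessian \<alpha> f x))"

definition log_cost :: "real \<Rightarrow> real^'n \<Rightarrow> real^'n \<Rightarrow> real" where
  "log_cost \<alpha> x y = 1 / \<alpha> * ln (1 + \<alpha> * (x \<bullet> y))"

definition exp_grad :: "real \<Rightarrow> (real^'n \<Rightarrow> real) \<Rightarrow> real^'n \<Rightarrow> real^'n" where
  "exp_grad \<alpha> f x = (1 / (1 - \<alpha> * (grad f x \<bullet> x))) *\<^sub>R grad f x"

text \<open>The \<open>(-\<alpha>)\<close>-conjugate of \<open>f\<close> on \<open>S\<close>, meaningful on \<open>exp_grad \<alpha> f ` S\<close>.\<close>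

definition exp_conjugate ::
    "real \<Rightarrow> (real^'n) set \<Rightarrow> (real^'n \<Rightarrow> real) \<Rightarrow> real^'n \<Rightarrow> real" where
  "exp_conjugate \<alpha> S f y =
     (let x = inv_into S (exp_grad \<alpha> f) y in log_cost \<alpha> x y - f x)"

definition L_divergence ::
    "real \<Rightarrow> (real^'n \<Rightarrow> real) \<Rightarrow> real^'n \<Rightarrow> real^'n \<Rightarrow> real" where
  "L_divergence \<alpha> f x x' =
     (f x - f x') - 1 / \<alpha> * ln (1 + \<alpha> * (grad f x' \<bullet> (x - x')))"

text \<open>An attained maximum over a possibly infinite set; \<^const>\<open>Max\<close> covers finite sets only.\<close>

definition is_maximum :: "real \<Rightarrow> ('a \<Rightarrow> real) \<Rightarrow> 'a set \<Rightarrow> bool" where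
  "is_maximum m f S \<longleftrightarrow> (\<exists>x\<in>S. f x = m) \<and> (\<forall>x\<in>S. f x \<le> m)"

text \<open>
  Under the regularity condition the denominator in \<^const>\<open>exp_grad\<close> and the argument of the
  logarithm in \<^const>\<open>log_cost\<close> are positive wherever these functions are used, so the totality
  conventions for division and \<^const>\<open>ln\<close> never matter.
\<close>

lemma exp_grad_denominator_pos:
  fixes S :: "(real^'n) set"
  assumes "0 \<in> S" and "\<And>x x'. x \<in> S \<Longrightarrow> x' \<in> S \<Longrightarrow> 1 + \<alpha> * (grad f x' \<bullet> (x - x')) > 0"
    and "x \<in> S"
  shows "1 - \<alpha> * (grad f x \<bullet> x) > 0"
  using assms(2)[OF assms(1,3)] by simp

lemma log_cost_argument_pos:
  fixes S :: "(real^'n) set"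
  assumes "0 \<in> S" and reg: "\<And>x x'. x \<in> S \<Longrightarrow> x' \<in> S \<Longrightarrow> 1 + \<alpha> * (grad f x' \<bullet> (x - x')) > 0"
    and "x \<in> S" and "y \<in> exp_grad \<alpha> f ` S"
  shows "1 + \<alpha> * (x \<bullet> y) > 0"
proof -
  obtain x' where x': "x' \<in> S" "y = exp_grad \<alpha> f x'"
    using assms(4) by blast
  have d: "1 - \<alpha> * (grad f x' \<bullet> x') > 0"
    using exp_grad_denominator_pos[OF assms(1) reg x'(1)] by simp
  have "1 + \<alpha> * (x \<bullet> y) = (1 + \<alpha> * (grad f x' \<bullet> (x - x'))) / (1 - \<alpha> * (grad f x' \<bullet> x'))"
    using d unfolding x'(2) exp_grad_def
    by (simp add: field_simps inner_diff_right inner_commute)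
  then show ?thesis
    using d reg[OF assms(3) x'(1)] by simp
qed

end

theory Submission
  imports Defs
begin

text \<open>
  Along segments \<open>exp (\<alpha> * \<phi>)\<close> has positive second derivative, so it lies strictly above its tangent
  planes. Taking logarithms, \<open>y\<close> is the unique maximiser of \<open>x \<mapsto> c(x, F y) - \<phi> x\<close>, where \<open>F\<close> is the
  exponential gradient; this gives injectivity of \<open>F\<close>, both maximum formulas and the self-dual
  representation. The derivative of \<open>F\<close> at \<open>x\<close> is the positive definite exponential Hessian \<open>A x\<close>
  followed by an invertible rank-one perturbation of the identity, so \<open>F\<close> is a diffeomorphism by
  invariance of domain and the inverse function theorem. The gradient of the conjugate at \<open>F x\<close> is a
  multiple of \<open>x\<close>, and with \<open>v\<close> the inverse of the derivative of \<open>F\<close> at \<open>x\<close> its exponential Hessian is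
  the pullback of \<open>A x\<close> under \<open>v\<close>, hence again positive definite.
\<close>

section \<open>Functions of class \<open>C\<^sup>k\<close>\<close>

lemma continuously_differentiable_on_has_derivative:
  assumes "continuously_differentiable_on (Suc k) f S" "x \<in> S"
  shows "(f has_derivative frechet_derivative f (at x)) (at x)"
  using assms by (simp flip: frechet_derivative_works)

text \<open>Since \<open>S\<close> is open, \<open>f\<close> and \<open>g\<close> agree near each of
  its points and so have the same derivative there; the directional derivatives then agree on
  \<open>S\<close> and the induction continues with them.\<close>

lemma continuously_differentiable_on_cong:
  assumes "open S" "\<And>x. x \<in> S \<Longrightarrow> f x = g x"
    and "continuously_differentiable_on k f S"
  shows "continuously_differentiable_on k g S"
  using assms(2,3)
proof (induction k arbitrary: f g)
  case 0
  then show ?case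
    unfolding continuously_differentiable_on.simps(1) using continuous_on_eq by blast
next
  case (Suc k)
  have der: "(g has_derivative frechet_derivative f (at x)) (at x)" if "x \<in> S" for x
    using has_derivative_transform_within_open[OF
        continuously_differentiable_on_has_derivative[OF Suc.prems(2) that] assms(1) that Suc.prems(1)] .
  have eq: "frechet_derivative f (at x) = frechet_derivative g (at x)" if "x \<in> S" for x
    using der[OF that] by (rule frechet_derivative_at)
  have "continuously_differentiable_on k (\<lambda>x. frechet_derivative g (at x) v) S" for v
  proof (rule Suc.IH)
    show "continuously_differentiable_on k (\<lambda>x. frechet_derivative f (at x) v) S"
      using Suc.prems(2) by simp
  qed (simp add: eq)
  then show ?case
    using der by (auto simp: differentiable_def)
qed

text \<open>Lets a derivative be supplied by an explicit formula: uniqueness of derivatives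
  identifies it on \<open>S\<close> with \<open>frechet_derivative\<close>.\<close>

lemma continuously_differentiable_on_SucI:
  assumes "open S" "\<And>x. x \<in> S \<Longrightarrow> (f has_derivative f' x) (at x)"
    and "\<And>v. continuously_differentiable_on k (\<lambda>x. f' x v) S"
  shows "continuously_differentiable_on (Suc k) f S"
proof -
  have "f' x = frechet_derivative f (at x)" if "x \<in> S" for x
    using frechet_derivative_at assms(2)[OF that] by blast
  then have "continuously_differentiable_on k (\<lambda>x. frechet_derivative f (at x) v) S" for v
    by (intro continuously_differentiable_on_cong[OF assms(1) _ assms(3)[of v]]) simp
  then show ?thesis
    using assms(2) by (auto simp: differentiable_def)
qed

lemma continuously_differentiable_on_SucD:
  assumes "continuously_differentiable_on (Suc k) f S"
  shows "continuously_differentiable_on k f S"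
  using assms
proof (induction k arbitrary: f)
  case 0
  then show ?case
    by (auto intro!: continuous_at_imp_continuous_on differentiable_imp_continuous_within)
next
  case (Suc k)
  have "continuously_differentiable_on k (\<lambda>x. frechet_derivative f (at x) v) S" for v
    by (intro Suc.IH) (use Suc.prems in auto)
  then show ?case
    using Suc.prems by simp
qed

section \<open>Closure of the class C^k under algebraic operations and composition\<close>

lemma continuously_differentiable_on_const:
  "open S \<Longrightarrow> continuously_differentiable_on k (\<lambda>x. c) S"
proof (induction k arbitrary: c)
  case (Suc k)
  then show ?case
    by (intro continuously_differentiable_on_SucI[where f' = "\<lambda>x v. 0"]) auto
qed simp

lemma continuously_differentiable_on_linear:
  assumes "open S" "bounded_linear f"
  shows "continuously_differentiable_on k f S"
proof (cases k)
  case 0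
  then show ?thesis
    using assms(2) by (simp add: linear_continuous_on)
next
  case (Suc m)
  show ?thesis
    unfolding Suc
    by (rule continuously_differentiable_on_SucI[where f' = "\<lambda>x. f"])
      (simp_all add: assms bounded_linear_imp_has_derivative continuously_differentiable_on_const)
qed

lemma continuously_differentiable_on_add:
  assumes "open S"
    and "continuously_differentiable_on k f S" "continuously_differentiable_on k g S"
  shows "continuously_differentiable_on k (\<lambda>x. f x + g x) S"
  using assms(2,3)
proof (induction k arbitrary: f g)
  case 0
  then show ?case
    by (simp add: continuous_on_add)
next
  case (Suc k)
  show ?case
  proof (rule continuously_differentiable_on_SucI[OF assms(1)])
    show "((\<lambda>x. f x + g x) has_derivative
        (\<lambda>v. frechet_derivative f (at x) v + frechet_derivative g (at x) v)) (at x)"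
      if "x \<in> S" for x
      using has_derivative_add[OF
          Suc.prems[THEN continuously_differentiable_on_has_derivative, OF that]] .
    show "continuously_differentiable_on k
        (\<lambda>x. frechet_derivative f (at x) v + frechet_derivative g (at x) v) S" for v
      using Suc.prems by (intro Suc.IH) simp_all
  qed
qed

text \<open>One product rule for all the products used here. Each term of the derivative keeps one
  factor undifferentiated, which is C^k by \<open>continuously_differentiable_on_SucD\<close>, so
  the induction has to generalise over both factors.\<close>

lemma continuously_differentiable_on_bilinear:
  assumes "bounded_bilinear h" "open S"
    and "continuously_differentiable_on k f S" "continuously_differentiable_on k g S"
  shows "continuously_differentiable_on k (\<lambda>x. h (f x) (g x)) S"
  using assms(3,4)
proof (induction k arbitrary: f g)
  case 0
  then show ?case
    by (simp add: bounded_bilinear.continuous_on[OF assms(1)])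
next
  case (Suc k)
  note lower = Suc.prems[THEN continuously_differentiable_on_SucD]
  show ?case
  proof (rule continuously_differentiable_on_SucI[OF assms(2)])
    show "((\<lambda>x. h (f x) (g x)) has_derivative
        (\<lambda>v. h (f x) (frechet_derivative g (at x) v) + h (frechet_derivative f (at x) v) (g x))) (at x)"
      if "x \<in> S" for x
      using bounded_bilinear.FDERIV[OF assms(1)
          Suc.prems[THEN continuously_differentiable_on_has_derivative, OF that]] .
    show "continuously_differentiable_on k
        (\<lambda>x. h (f x) (frechet_derivative g (at x) v) + h (frechet_derivative f (at x) v) (g x)) S" for v
      using Suc.prems by (intro continuously_differentiable_on_add[OF assms(2)] Suc.IH lower) simp_all
  qed
qed

lemmas continuously_differentiable_on_mult =
  continuously_differentiable_on_bilinear[OF bounded_bilinear_mult]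

lemmas continuously_differentiable_on_inner =
  continuously_differentiable_on_bilinear[OF bounded_bilinear_inner]

lemmas continuously_differentiable_on_scaleR =
  continuously_differentiable_on_bilinear[OF bounded_bilinear_scaleR]

lemma continuously_differentiable_on_sum:
  assumes "open S" "\<And>i. i \<in> I \<Longrightarrow> continuously_differentiable_on k (f i) S"
  shows "continuously_differentiable_on k (\<lambda>x. \<Sum>i\<in>I. f i x) S"
  using assms(2)
  \<comment> \<open>For infinite \<open>I\<close> the sum has the default value 0, a constant
    function.\<close>
  by (induction I rule: infinite_finite_induct)
    (simp_all add: assms(1) continuously_differentiable_on_const continuously_differentiable_on_add)

lemma continuously_differentiable_on_prod:
  fixes f :: "'i \<Rightarrow> 'a::euclidean_space \<Rightarrow> real"
  assumes "open S" "\<And>i. i \<in> I \<Longrightarrow> continuously_differentiable_on k (f i) S"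
  shows "continuously_differentiable_on k (\<lambda>x. \<Prod>i\<in>I. f i x) S"
  using assms(2)
  by (induction I rule: infinite_finite_induct)
    (simp_all add: assms(1) continuously_differentiable_on_const continuously_differentiable_on_mult)

lemma continuously_differentiable_on_compose:
  assumes "open S" "open T" "f ` S \<subseteq> T"
    and "continuously_differentiable_on k f S" "continuously_differentiable_on k g T"
  shows "continuously_differentiable_on k (\<lambda>x. g (f x)) S"
  using assms(4,5)
proof (induction k arbitrary: g)
  case 0
  then show ?case
    using assms(3) continuous_on_compose2 by auto
next
  case (Suc k)
  let ?Df = "\<lambda>x. frechet_derivative f (at x)" and ?Dg = "\<lambda>y. frechet_derivative g (at y)"
  note lower = Suc.prems(1)[THEN continuously_differentiable_on_SucD]
  have dg: "(g has_derivative ?Dg (f x)) (at (f x))" if "x \<in> S" for x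
    using that assms(3) by (intro continuously_differentiable_on_has_derivative[OF Suc.prems(2)]) auto
  show ?case
  proof (rule continuously_differentiable_on_SucI[OF assms(1)])
    show "((\<lambda>x. g (f x)) has_derivative (\<lambda>v. ?Dg (f x) (?Df x v))) (at x)" if "x \<in> S" for x
      using has_derivative_compose[OF
          continuously_differentiable_on_has_derivative[OF Suc.prems(1) that] dg[OF that]] .
    fix v
    \<comment> \<open>In the chain rule both the base point and the argument of \<open>?Dg\<close>
      vary with \<open>x\<close>. Expanding the argument in the basis leaves only fixed directions
      \<open>b\<close>, to which the induction hypothesis applies.\<close>
    have "continuously_differentiable_on k
        (\<lambda>x. \<Sum>b\<in>Basis. (?Df x v \<bullet> b) *\<^sub>R ?Dg (f x) b) S"
    proof (intro continuously_differentiable_on_sum continuously_differentiable_on_scaleR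
        continuously_differentiable_on_inner continuously_differentiable_on_const assms(1))
      show "continuously_differentiable_on k (\<lambda>x. ?Df x v) S"
        using Suc.prems(1) by simp
      show "continuously_differentiable_on k (\<lambda>x. ?Dg (f x) b) S" for b
        using Suc.prems(2) by (intro Suc.IH[OF lower, of "\<lambda>y. ?Dg y b"]) simp
    qed
    moreover have "(\<Sum>b\<in>Basis. (?Df x v \<bullet> b) *\<^sub>R ?Dg (f x) b) = ?Dg (f x) (?Df x v)"
      if "x \<in> S" for x
      using linear_sum[OF has_derivative_linear[OF dg[OF that]], of "\<lambda>b. (?Df x v \<bullet> b) *\<^sub>R b" Basis]
        linear_scale[OF has_derivative_linear[OF dg[OF that]]]
      by (simp add: euclidean_representation)
    ultimately show "continuously_differentiable_on k (\<lambda>x. ?Dg (f x) (?Df x v)) S"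
      by (rule continuously_differentiable_on_cong[OF assms(1), rotated])
  qed
qed

text \<open>The derivative of 1/f is a product of 1/f with itself and the derivative of f, so
  smoothness of 1/f bootstraps.\<close>

lemma continuously_differentiable_on_inverse:
  fixes f :: "'a::euclidean_space \<Rightarrow> real"
  assumes "open S" "\<And>x. x \<in> S \<Longrightarrow> f x \<noteq> 0" "continuously_differentiable_on k f S"
  shows "continuously_differentiable_on k (\<lambda>x. inverse (f x)) S"
  using assms(3)
proof (induction k)
  case 0
  then show ?case
    using assms(2) by (simp add: continuous_on_inverse)
next
  case (Suc k)
  note IH = Suc.IH[OF continuously_differentiable_on_SucD[OF Suc.prems]]
  show ?case
  proof (rule continuously_differentiable_on_SucI[OF assms(1)])
    show "((\<lambda>x. inverse (f x)) has_derivative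
        (\<lambda>v. (- 1) * (inverse (f x) * (frechet_derivative f (at x) v * inverse (f x))))) (at x)"
      if "x \<in> S" for x
      using Deriv.has_derivative_inverse[OF assms(2)[OF that]
          continuously_differentiable_on_has_derivative[OF Suc.prems that]]
      by (simp add: mult.assoc)
    show "continuously_differentiable_on k
        (\<lambda>x. (- 1) * (inverse (f x) * (frechet_derivative f (at x) v * inverse (f x)))) S" for v
      using Suc.prems
      by (intro continuously_differentiable_on_mult continuously_differentiable_on_const IH
          assms(1)) simp
  qed
qed

lemma continuously_differentiable_on_vec_nth:
  fixes f :: "'a::euclidean_space \<Rightarrow> real^'n"
  assumes "open S" "continuously_differentiable_on k f S"
  shows "continuously_differentiable_on k (\<lambda>x. f x $ i) S"
  using continuously_differentiable_on_inner[OF assms(1) assms(2)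
      continuously_differentiable_on_const[OF assms(1), of _ "axis i 1"]]
  by (simp add: inner_axis)

lemma continuously_differentiable_on_vec_lambda:
  fixes f :: "'n::finite \<Rightarrow> 'a::euclidean_space \<Rightarrow> real"
  assumes "open S" "\<And>i. continuously_differentiable_on k (f i) S"
  shows "continuously_differentiable_on k (\<lambda>x. \<chi> i. f i x) S"
proof -
  have "(\<chi> i. f i x) = (\<Sum>i\<in>UNIV. f i x *\<^sub>R axis i 1)" for x
    by (simp add: vec_eq_iff axis_def if_distrib cong: if_cong)
  then show ?thesis
    using assms by (simp add: continuously_differentiable_on_sum continuously_differentiable_on_scaleR
        continuously_differentiable_on_const)
qed

lemma continuously_differentiable_on_det:
  fixes A :: "'a::euclidean_space \<Rightarrow> real^'n^'n"
  assumes "open S" "\<And>i j. continuously_differentiable_on k (\<lambda>x. A x $ i $ j) S"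
  shows "continuously_differentiable_on k (\<lambda>x. det (A x)) S"
  unfolding det_def
  by (intro continuously_differentiable_on_sum continuously_differentiable_on_mult
      continuously_differentiable_on_const continuously_differentiable_on_prod assms)

text \<open>
  The derivative of the inverse map solves a linear system whose matrix is the Jacobian of \<open>f\<close>, and
  Cramer's rule expresses the solution through determinants; so the inverse gains one order of
  differentiability at a time.
\<close>

lemma diffeomorphism_inv_into:
  fixes f :: "real^'n \<Rightarrow> real^'n"
  assumes "open S" "smooth_on f S" "inj_on f S"
    and inj: "\<And>x. x \<in> S \<Longrightarrow> inj (frechet_derivative f (at x))"
  shows "diffeomorphism S (f ` S) f (inv_into S f)"
    and "\<And>x. x \<in> S \<Longrightarrow>
      (inv_into S f has_derivative inv (frechet_derivative f (at x))) (at (f x))"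
proof -
  let ?T = "f ` S" and ?g = "inv_into S f" and ?D = "\<lambda>x. frechet_derivative f (at x)"
  have smooth: "continuously_differentiable_on k f S" for k
    using assms(2) by (simp add: smooth_on_def)
  have der: "(f has_derivative ?D x) (at x)" if "x \<in> S" for x
    using continuously_differentiable_on_has_derivative[OF smooth that] .
  have cont: "continuous_on S f"
    using smooth[of 0] by simp
  \<comment> \<open>Invariance of domain gives openness of the image and, next, continuity of the
    inverse, which the rule for the derivative of an inverse takes as a premise.\<close>
  have openT: "open ?T"
    using invariance_of_domain_gen[OF assms(1) cont assms(3)] by simp
  have contg: "continuous_on ?T ?g"
    by (rule continuous_on_inverse_open[OF assms(1) cont]) (simp_all add: assms(3))
  have bij: "bij (?D x)" if "x \<in> S" for x
    using linear_injective_imp_surjective[OF has_derivative_linear[OF der[OF that]] inj[OF that]]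
      inj[OF that] by (simp add: bij_def)
  have derg: "(?g has_derivative inv (?D (?g y))) (at y)" if y: "y \<in> ?T" for y
  proof (rule has_derivative_inverse_basic[OF _ _ _ _ openT y])
    have x: "?g y \<in> S"
      using y by (rule inv_into_into)
    show "(f has_derivative ?D (?g y)) (at (?g y))"
      using der[OF x] .
    show "bounded_linear (inv (?D (?g y)))"
      using linear_conv_bounded_linear inj_linear_imp_inv_linear has_derivative_linear[OF der[OF x]]
        inj[OF x] by blast
    show "inv (?D (?g y)) \<circ> ?D (?g y) = id"
      using inj[OF x] by simp
    show "continuous (at y) ?g"
      using contg openT y continuous_on_eq_continuous_at by blast
    show "f (?g z) = z" if "z \<in> ?T" for z
      using that by (rule f_inv_into_f)
  qed
  then show "(?g has_derivative inv (?D x)) (at (f x))" if "x \<in> S" for x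
    using that assms(3) by force
  have "continuously_differentiable_on k ?g ?T" for k
  proof (induction k)
    case 0
    then show ?case
      using contg by simp
  next
    case (Suc k)
    define M where "M x = matrix (?D x)" for x
    have M: "M x *v v = ?D x v" if "x \<in> S" for x v
      unfolding M_def by (rule matrix_works) (rule has_derivative_linear[OF der[OF that], folded linear_matrix_vector_mul_eq])
    have det: "det (M x) \<noteq> 0" if "x \<in> S" for x
      unfolding M_def using det_nz_iff_inj[OF has_derivative_linear[OF der[OF that]]] inj[OF that] by simp
    have cM: "continuously_differentiable_on k (\<lambda>y. M (?g y) $ i $ j) ?T" for i j
    proof (rule continuously_differentiable_on_compose[OF openT assms(1) _ Suc.IH])
      show "?g ` ?T \<subseteq> S"
        by (auto intro: inv_into_into)
      show "continuously_differentiable_on k (\<lambda>x. M x $ i $ j) S"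
        unfolding M_def matrix_def using smooth[of "Suc k"]
        by (auto intro!: continuously_differentiable_on_vec_nth[OF assms(1)])
    qed
    show ?case
    proof (rule continuously_differentiable_on_SucI[OF openT derg])
      fix v
      \<comment> \<open>The numerator matrix of Cramer's rule: column \<open>m\<close> of the
        Jacobian is replaced by the constant vector \<open>v\<close>.\<close>
      have entry: "continuously_differentiable_on k
          (\<lambda>y. (\<chi> i j. if j = m then v $ i else M (?g y) $ i $ j) $ i $ j) ?T" for i j m
        using cM[of i j] continuously_differentiable_on_const[OF openT]
        by (cases "j = m") simp_all
      have "continuously_differentiable_on k
          (\<lambda>y. \<chi> m. det (\<chi> i j. if j = m then v $ i else M (?g y) $ i $ j)
            * inverse (det (M (?g y)))) ?T"
      proof (intro continuously_differentiable_on_vec_lambda continuously_differentiable_on_mult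
          continuously_differentiable_on_inverse continuously_differentiable_on_det openT entry cM)
        show "det (M (?g y)) \<noteq> 0" if "y \<in> ?T" for y
          using det that by (simp add: inv_into_into)
      qed
      moreover have "(\<chi> m. det (\<chi> i j. if j = m then v $ i else M (?g y) $ i $ j)
          * inverse (det (M (?g y)))) = inv (?D (?g y)) v" if "y \<in> ?T" for y
      proof -
        have x: "?g y \<in> S"
          using that by (rule inv_into_into)
        have "M (?g y) *v inv (?D (?g y)) v = v"
          using M[OF x] bij[OF x] by (simp add: bij_is_surj surj_f_inv_f)
        then show ?thesis
          using cramer[OF det[OF x], of "inv (?D (?g y)) v" v] by (simp add: divide_inverse)
      qed
      ultimately show "continuously_differentiable_on k (\<lambda>y. inv (?D (?g y)) v) ?T"
        by (rule continuously_differentiable_on_cong[OF openT, rotated])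
    qed
  qed
  then have "smooth_on ?g ?T"
    by (simp add: smooth_on_def)
  moreover have "homeomorphism S ?T f ?g"
    using cont contg assms(3) by (auto simp: homeomorphism_def inv_into_into f_inv_into_f)
  ultimately show "diffeomorphism S ?T f ?g"
    using assms(1,2) openT by (simp add: diffeomorphism_def)
qed

section \<open>Gradients and exponential Hessians\<close>

lemma grad_eqI:
  assumes "(f has_derivative (\<lambda>v. v \<bullet> D)) (at x)"
  shows "grad f x = D"
  unfolding grad_def
proof (rule the_equality)
  show "GDERIV f x :> D"
    using assms by (simp add: gderiv_def)
  fix D' assume "GDERIV f x :> D'"
  then have "(\<lambda>v. v \<bullet> D') = (\<lambda>v. v \<bullet> D)"
    using assms has_derivative_unique by (auto simp: gderiv_def)
  then show "D' = D"
    by (metis vector_eq_ldot)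
qed

text \<open>Riesz representation: the adjoint of the derivative, applied to 1, is the
  gradient.\<close>

lemma has_derivative_grad:
  assumes "f differentiable at x"
  shows "(f has_derivative (\<lambda>v. v \<bullet> grad f x)) (at x)"
proof -
  obtain f' where f': "(f has_derivative f') (at x)"
    using assms by (auto simp: differentiable_def)
  have "f' = (\<lambda>v. v \<bullet> adjoint f' 1)"
    using adjoint_works[OF has_derivative_linear[OF f']] by simp
  then have g: "(f has_derivative (\<lambda>v. v \<bullet> adjoint f' 1)) (at x)"
    using f' by simp
  then show ?thesis
    unfolding grad_eqI[OF g] .
qed

lemma continuously_differentiable_on_grad:
  assumes "open S" "continuously_differentiable_on (Suc k) f S"
  shows "continuously_differentiable_on k (grad f) S"
proof (rule continuously_differentiable_on_cong[OF assms(1)])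
  show "continuously_differentiable_on k (\<lambda>x. \<chi> i. frechet_derivative f (at x) (axis i 1)) S"
    using assms(2) by (intro continuously_differentiable_on_vec_lambda[OF assms(1)]) simp
  fix x assume "x \<in> S"
  then have "(f has_derivative (\<lambda>v. v \<bullet> grad f x)) (at x)"
    using assms(2) by (intro has_derivative_grad) simp
  from frechet_derivative_at[OF this]
  show "(\<chi> i. frechet_derivative f (at x) (axis i 1)) = grad f x"
    by (metis (no_types, lifting) inner_axis' mult_1 real_inner_1_left vec_lambda_unique)
qed

lemma continuously_differentiable_on_Suc_of_gradient:
  fixes f :: "real^'n \<Rightarrow> real"
  assumes "open S" "\<And>x. x \<in> S \<Longrightarrow> (f has_derivative (\<lambda>v. v \<bullet> G x)) (at x)"
    and "continuously_differentiable_on k G S"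
  shows "continuously_differentiable_on (Suc k) f S"
  using assms
  by (intro continuously_differentiable_on_SucI[OF assms(1,2)])
    (auto intro: continuously_differentiable_on_inner continuously_differentiable_on_const)

text \<open>The product of column and row vector is the rank-one map sending \<open>v\<close> to
  \<open>(y \<bullet> v) *\<^sub>R y\<close>. This replaces the matrix by a coordinate-free
  formula.\<close>

lemma exp_hessian_mult:
  fixes f :: "real^'n \<Rightarrow> real"
  assumes "(grad f has_derivative H) (at x)"
  shows "exp_hessian \<alpha> f x *v v = H v + (\<alpha> * (grad f x \<bullet> v)) *\<^sub>R grad f x"
proof -
  have "hessian f x *v v = H v"
    unfolding hessian_def jacobian_def frechet_derivative_at[OF assms, symmetric]
    by (rule matrix_works) (rule has_derivative_linear[OF assms, folded linear_matrix_vector_mul_eq])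
  moreover have "((columnvector y :: real^1^'n) ** rowvector y) *v v = (y \<bullet> v) *\<^sub>R y" for y :: "real^'n"
    by (simp add: vec_eq_iff matrix_vector_mult_def matrix_matrix_mult_def columnvector_def
        rowvector_def inner_vec_def sum_distrib_left mult_ac)
  ultimately show ?thesis
    by (simp add: exp_hessian_def matrix_vector_mult_add_rdistrib scaleR_matrix_vector_assoc[symmetric])
qed

text \<open>Checks symmetry through the bilinear form, which suits a matrix known only as a
  pullback.\<close>

lemma pos_definiteI:
  assumes "\<And>u v. u \<bullet> (A *v v) = (A *v u) \<bullet> v" "\<And>v. v \<noteq> 0 \<Longrightarrow> v \<bullet> (A *v v) > 0"
  shows "pos_definite A"
proof -
  have "transpose A *v u = A *v u" for u
    using assms(1) by (metis dot_lmul_matrix transpose_matrix_vector vector_eq_rdot)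
  then show ?thesis
    using assms(2) by (simp add: pos_definite_def matrix_eq)
qed

lemma pos_definite_inner_commute:
  "pos_definite A \<Longrightarrow> u \<bullet> (A *v v) = (A *v u) \<bullet> v"
  by (metis dot_lmul_matrix transpose_matrix_vector pos_definite_def)

text \<open>The left side is the tangent plane of exp (\<alpha> f) at \<open>y\<close>, evaluated at
  \<open>x\<close>. The Hessian of exp (\<alpha> f) is \<alpha> exp (\<alpha> f) times
  \<open>exp_hessian\<close>, so the second derivative along the segment is strictly
  positive.\<close>

lemma exp_tangent_less:
  fixes f :: "real^'n \<Rightarrow> real"
  assumes "\<alpha> > 0" "open S" "convex S" and C2: "continuously_differentiable_on 2 f S"
    and pd: "\<And>x. x \<in> S \<Longrightarrow> pos_definite (exp_hessian \<alpha> f x)"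
    and "x \<in> S" "y \<in> S" "x \<noteq> y"
  shows "exp (\<alpha> * f y) * (1 + \<alpha> * (grad f y \<bullet> (x - y))) < exp (\<alpha> * f x)"
proof -
  define d where "d = x - y"
  define p where "p t = y + t *\<^sub>R d" for t
  define h where "h t = exp (\<alpha> * f (p t))" for t
  define h' where "h' t = \<alpha> * (grad f (p t) \<bullet> d) * h t" for t
  let ?h'' = "\<lambda>t. \<alpha> * (d \<bullet> (exp_hessian \<alpha> f (p t) *v d)) * h t"
  have p: "p t \<in> S" if "0 \<le> t" "t \<le> 1" for t
  proof -
    have "p t = (1 - t) *\<^sub>R y + t *\<^sub>R x"
      by (simp add: p_def d_def algebra_simps)
    then show ?thesis
      using convexD[OF assms(3) assms(7,6), of "1 - t" t] that by simp
  qed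
  have C2': "continuously_differentiable_on (Suc (Suc 0)) f S"
    using C2 by (simp only: numeral_2_eq_2)
  have dp: "(p has_derivative (\<lambda>s. s *\<^sub>R d)) (at t)" for t
    unfolding p_def by (auto intro!: derivative_eq_intros)
  have h: "(h has_real_derivative h' t) (at t)" if "0 \<le> t" "t \<le> 1" for t
  proof -
    have "(f has_derivative (\<lambda>v. v \<bullet> grad f (p t))) (at (p t))"
      using C2' p[OF that] by (intro has_derivative_grad) simp
    from has_derivative_compose[OF dp this]
    have "((\<lambda>t. f (p t)) has_real_derivative grad f (p t) \<bullet> d) (at t)"
      by (rule has_derivative_imp_has_field_derivative) (simp add: inner_commute)
    then show ?thesis
      unfolding h_def h'_def by (auto intro!: derivative_eq_intros)
  qed
  have h': "(h' has_real_derivative ?h'' t) (at t)" if "0 \<le> t" "t \<le> 1" for t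
  proof -
    let ?H = "frechet_derivative (grad f) (at (p t))"
    have H: "(grad f has_derivative ?H) (at (p t))"
      using continuously_differentiable_on_has_derivative[OF
          continuously_differentiable_on_grad[OF assms(2) C2'] p[OF that]] .
    from has_derivative_inner_left[OF has_derivative_compose[OF dp H], of d]
    have "((\<lambda>t. grad f (p t) \<bullet> d) has_real_derivative ?H d \<bullet> d) (at t)"
      by (rule has_derivative_imp_has_field_derivative)
        (simp add: linear_scale[OF has_derivative_linear[OF H]])
    then have "(h' has_real_derivative
        \<alpha> * (grad f (p t) \<bullet> d) * h' t + \<alpha> * (?H d \<bullet> d) * h t) (at t)"
      unfolding h'_def using h[OF that, unfolded h'_def] by (auto intro!: derivative_eq_intros)
    \<comment> \<open>Differentiating the factor \<open>h\<close> contributes the squared slope,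
      which is the rank-one part of \<open>exp_hessian\<close>.\<close>
    moreover have "\<alpha> * (grad f (p t) \<bullet> d) * h' t + \<alpha> * (?H d \<bullet> d) * h t = ?h'' t"
      by (simp add: exp_hessian_mult[OF H] h'_def inner_add_right inner_commute algebra_simps)
    ultimately show ?thesis
      by simp
  qed
  \<comment> \<open>The mean value theorem is used twice: the increment of \<open>h\<close> equals
    \<open>h' c\<close>, and \<open>h' c\<close> exceeds \<open>h' 0\<close> by a positive multiple
    of the second derivative at \<open>e\<close>.\<close>
  obtain c where c: "0 < c" "c < 1" "h 1 - h 0 = (1 - 0) * h' c"
    using MVT2[of 0 1 h h'] h by auto
  obtain e where e: "0 < e" "e < c" "h' c - h' 0 = (c - 0) * ?h'' e"
    using MVT2[of 0 c h' ?h''] h' c by auto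
  have "?h'' e > 0"
    using pd[OF p[of e]] e c assms(1,8) by (simp add: pos_definite_def d_def h_def)
  then have "h' c > h' 0"
    using e c by (metis diff_gt_0_iff_gt diff_zero mult_pos_pos)
  then have "h 0 + h' 0 < h 1"
    using c by simp
  then show ?thesis
    by (simp add: h_def h'_def p_def d_def algebra_simps)
qed

section \<open>Duality\<close>

locale exp_convex_potential =
  fixes \<alpha> :: real and \<Omega> :: "(real^'n) set" and \<phi> :: "real^'n \<Rightarrow> real"
  assumes alpha_pos: "\<alpha> > 0"
    and open_dom: "open \<Omega>" and convex_dom: "convex \<Omega>"
    and smooth: "smooth_on \<phi> \<Omega>"
    and exp_hessian_pos: "\<And>x. x \<in> \<Omega> \<Longrightarrow> pos_definite (exp_hessian \<alpha> \<phi> x)"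
    and zero_in_dom: "0 \<in> \<Omega>"
    and tangent_pos: "\<And>x y. x \<in> \<Omega> \<Longrightarrow> y \<in> \<Omega> \<Longrightarrow> 1 + \<alpha> * (grad \<phi> y \<bullet> (x - y)) > 0"
begin

section \<open>Strict maximisation, the conjugate and the self-dual divergence\<close>

abbreviation "F \<equiv> exp_grad \<alpha> \<phi>"
abbreviation "F_inv \<equiv> inv_into \<Omega> F"
abbreviation "\<psi> \<equiv> exp_conjugate \<alpha> \<Omega> \<phi>"

text \<open>This is the bracket of the regularity condition with the origin as first point, which is
  where positivity comes from.\<close>

definition "denom x = 1 - \<alpha> * (grad \<phi> x \<bullet> x)"

lemma denom_pos: "x \<in> \<Omega> \<Longrightarrow> denom x > 0"
  unfolding denom_def using exp_grad_denominator_pos[OF zero_in_dom tangent_pos] .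

lemma exp_grad_eq: "F x = inverse (denom x) *\<^sub>R grad \<phi> x"
  by (simp add: exp_grad_def denom_def divide_inverse)

lemma grad_eq: "x \<in> \<Omega> \<Longrightarrow> grad \<phi> x = denom x *\<^sub>R F x"
  using denom_pos[of x] by (simp add: exp_grad_eq)

text \<open>Dividing the gradient by \<open>denom y\<close> turns
  \<open>1 + \<alpha> * (x \<bullet> F y)\<close> into the tangent bracket at \<open>y\<close> over
  \<open>denom y\<close>. Up to a constant in \<open>x\<close>, the cost is thus the logarithmic
  term of the divergence.\<close>

lemma log_cost_exp_grad:
  assumes "x \<in> \<Omega>" "y \<in> \<Omega>"
  shows "log_cost \<alpha> x (F y) =
    1 / \<alpha> * (ln (1 + \<alpha> * (grad \<phi> y \<bullet> (x - y))) - ln (denom y))"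
proof -
  have "1 + \<alpha> * (x \<bullet> F y) = (1 + \<alpha> * (grad \<phi> y \<bullet> (x - y))) / denom y"
    using denom_pos[OF assms(2)]
    by (simp add: exp_grad_eq inner_diff_right inner_commute field_simps)
      (simp add: denom_def inner_commute algebra_simps)
  then show ?thesis
    using denom_pos[OF assms(2)] tangent_pos[OF assms] by (simp add: log_cost_def ln_div)
qed

lemma log_cost_minus_less:
  assumes "x \<in> \<Omega>" "y \<in> \<Omega>" "x \<noteq> y"
  shows "log_cost \<alpha> x (F y) - \<phi> x < log_cost \<alpha> y (F y) - \<phi> y"
proof -
  let ?t = "1 + \<alpha> * (grad \<phi> y \<bullet> (x - y))"
  have "exp (\<alpha> * \<phi> y) * ?t < exp (\<alpha> * \<phi> x)"
    using smooth by (intro exp_tangent_less[OF alpha_pos open_dom convex_dom _ exp_hessian_pos assms])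
      (simp add: smooth_on_def)
  \<comment> \<open>Logarithms turn the tangent inequality into positivity of the divergence; at
    \<open>y\<close> itself the bracket is 1 and its logarithm vanishes.\<close>
  then have "ln (exp (\<alpha> * \<phi> y) * ?t) < ln (exp (\<alpha> * \<phi> x))"
    using tangent_pos[OF assms(1,2)] by (subst ln_less_cancel_iff) auto
  then have "\<alpha> * \<phi> y + ln ?t < \<alpha> * \<phi> x"
    using tangent_pos[OF assms(1,2)] by (simp add: ln_mult)
  then have "1 / \<alpha> * ln ?t < \<phi> x - \<phi> y"
    using alpha_pos by (simp add: field_simps)
  then show ?thesis
    using assms by (simp add: log_cost_exp_grad right_diff_distrib diff_divide_distrib)
qed

text \<open>Two distinct points with the same image would each be the strict maximiser of one and
  the same function.\<close>

lemma inj_on_exp_grad: "inj_on F \<Omega>"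
proof (rule inj_onI, rule ccontr)
  fix x y assume xy: "x \<in> \<Omega>" "y \<in> \<Omega>" "F x = F y" "x \<noteq> y"
  show False
    using log_cost_minus_less[OF xy(1,2,4)] log_cost_minus_less[OF xy(2,1) xy(4)[symmetric]] xy(3)
    by simp
qed

lemma exp_conjugate_exp_grad: "x \<in> \<Omega> \<Longrightarrow> \<psi> (F x) = log_cost \<alpha> x (F x) - \<phi> x"
  by (simp add: exp_conjugate_def inv_into_f_f[OF inj_on_exp_grad])

text \<open>Equality holds for \<open>x = y\<close>; fixing either argument then yields one of the
  two maximum formulas.\<close>

lemma fenchel_young:
  assumes "x \<in> \<Omega>" "y \<in> \<Omega>"
  shows "log_cost \<alpha> x (F y) \<le> \<phi> x + \<psi> (F y)"
  using log_cost_minus_less[OF assms] assms(2)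
  by (cases "x = y") (auto simp: exp_conjugate_exp_grad)

lemma L_divergence_self_dual:
  assumes "x \<in> \<Omega>" "y \<in> \<Omega>"
  shows "L_divergence \<alpha> \<phi> x y = \<phi> x + \<psi> (F y) - log_cost \<alpha> x (F y)"
  using assms by (simp add: L_divergence_def exp_conjugate_exp_grad log_cost_exp_grad algebra_simps)

section \<open>The derivative of the exponential gradient\<close>

abbreviation "A x \<equiv> exp_hessian \<alpha> \<phi> x"
abbreviation "DF x \<equiv> frechet_derivative F (at x)"

lemma continuously_differentiable_on_grad_potential:
  "continuously_differentiable_on k (grad \<phi>) \<Omega>"
  using smooth by (intro continuously_differentiable_on_grad[OF open_dom]) (auto simp: smooth_on_def)

lemma smooth_exp_grad: "smooth_on F \<Omega>"
proof -
  have "continuously_differentiable_on k F \<Omega>" for k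
  proof -
    have "continuously_differentiable_on k (\<lambda>x. 1 + (- \<alpha>) * (grad \<phi> x \<bullet> x)) \<Omega>"
      by (intro continuously_differentiable_on_add continuously_differentiable_on_mult
          continuously_differentiable_on_inner continuously_differentiable_on_const
          continuously_differentiable_on_grad_potential open_dom
          continuously_differentiable_on_linear bounded_linear_ident)
    then have "continuously_differentiable_on k denom \<Omega>"
      by (simp add: denom_def[abs_def])
    then have "continuously_differentiable_on k (\<lambda>x. inverse (denom x) *\<^sub>R grad \<phi> x) \<Omega>"
      using denom_pos
      by (intro continuously_differentiable_on_scaleR continuously_differentiable_on_inverse
          continuously_differentiable_on_grad_potential open_dom) force+
    then show ?thesis
      by (simp add: exp_grad_eq[abs_def])
  qed
  then show ?thesis
    by (simp add: smooth_on_def)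
qed

lemma exp_grad_has_derivative:
  assumes "x \<in> \<Omega>"
  shows "(F has_derivative DF x) (at x)"
  using smooth_exp_grad assms
  by (intro continuously_differentiable_on_has_derivative[of 0]) (auto simp: smooth_on_def)

text \<open>
  Up to the factor \<open>1 / denom x\<close>, the derivative of \<open>F\<close> is the exponential Hessian followed by a
  rank-one perturbation of the identity, whose inverse is \<open>w \<mapsto> w - \<alpha> (x \<bullet> w) grad \<phi> x\<close>.
\<close>

lemma exp_hessian_via_DF:
  assumes x: "x \<in> \<Omega>"
  shows "DF x v - (\<alpha> * (x \<bullet> DF x v)) *\<^sub>R grad \<phi> x = inverse (denom x) *\<^sub>R (A x *v v)"
proof -
  let ?g = "grad \<phi> x" and ?H = "frechet_derivative (grad \<phi>) (at x)" and ?p = "denom x"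
  have p: "?p \<noteq> 0"
    using denom_pos[OF x] by simp
  have H: "(grad \<phi> has_derivative ?H) (at x)"
    using continuously_differentiable_on_has_derivative[OF
        continuously_differentiable_on_grad_potential x] .
  \<comment> \<open>The derivative of \<open>denom\<close> at \<open>x\<close> in direction
    \<open>v\<close> is -\<alpha> \<open>q\<close>.\<close>
  define q where "q = ?H v \<bullet> x + ?g \<bullet> v"
  have "(denom has_derivative (\<lambda>v. - (\<alpha> * (?H v \<bullet> x + ?g \<bullet> v)))) (at x)"
    unfolding denom_def[abs_def] by (auto intro!: derivative_eq_intros H simp: algebra_simps)
  from has_derivative_scaleR[OF Deriv.has_derivative_inverse[OF p this] H]
  have "(F has_derivative (\<lambda>v. inverse ?p *\<^sub>R ?H v
      + - (inverse ?p * - (\<alpha> * (?H v \<bullet> x + ?g \<bullet> v)) * inverse ?p) *\<^sub>R ?g)) (at x)"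
    by (simp add: exp_grad_eq[abs_def])
  from frechet_derivative_at[OF this, symmetric]
  have DF: "DF x v = inverse ?p *\<^sub>R ?H v + (\<alpha> * q * (inverse ?p)\<^sup>2) *\<^sub>R ?g"
    by (simp add: q_def power2_eq_square algebra_simps)
  \<comment> \<open>Here \<alpha> times the inner product of \<open>?g\<close> and \<open>x\<close>
    is rewritten as \<open>1 - ?p\<close>; in the next identity the terms with
    \<open>?H v \<bullet> x\<close> then cancel.\<close>
  have "\<alpha> * (x \<bullet> DF x v) =
      \<alpha> * (?H v \<bullet> x) * inverse ?p + \<alpha> * q * (inverse ?p)\<^sup>2 * (1 - ?p)"
    unfolding DF by (simp add: denom_def inner_add_right inner_commute algebra_simps)
  moreover have "\<alpha> * q * (inverse ?p)\<^sup>2 - (\<alpha> * (?H v \<bullet> x) * inverse ?p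
      + \<alpha> * q * (inverse ?p)\<^sup>2 * (1 - ?p)) = inverse ?p * (\<alpha> * (?g \<bullet> v))"
    using p by (simp add: q_def field_simps power2_eq_square)
  ultimately have coeff: "\<alpha> * q * (inverse ?p)\<^sup>2 - \<alpha> * (x \<bullet> DF x v)
      = inverse ?p * (\<alpha> * (?g \<bullet> v))"
    by simp
  have "DF x v - c *\<^sub>R ?g = inverse ?p *\<^sub>R ?H v + (\<alpha> * q * (inverse ?p)\<^sup>2 - c) *\<^sub>R ?g" for c
    unfolding DF by (simp add: scaleR_diff_left)
  then show ?thesis
    unfolding exp_hessian_mult[OF H] by (simp add: coeff scaleR_add_right)
qed

text \<open>A vector in the kernel of \<open>DF x\<close> makes the left side of
  \<open>exp_hessian_via_DF\<close> vanish, hence lies in the kernel of the positive definite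
  \<open>A x\<close>.\<close>

lemma inj_DF:
  assumes x: "x \<in> \<Omega>"
  shows "inj (DF x)"
proof -
  have "v = 0" if "DF x v = 0" for v
    using exp_hessian_via_DF[OF x, of v] that denom_pos[OF x] exp_hessian_pos[OF x]
    by (auto simp: pos_definite_def)
  then show ?thesis
    using linear_injective_0 has_derivative_linear[OF exp_grad_has_derivative[OF x]] by blast
qed

lemma diffeomorphism_exp_grad: "diffeomorphism \<Omega> (F ` \<Omega>) F F_inv"
  using diffeomorphism_inv_into(1)[OF open_dom smooth_exp_grad inj_on_exp_grad inj_DF] .

lemma F_inv_has_derivative:
  "x \<in> \<Omega> \<Longrightarrow> (F_inv has_derivative inv (DF x)) (at (F x))"
  using diffeomorphism_inv_into(2)[OF open_dom smooth_exp_grad inj_on_exp_grad inj_DF] .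

lemma DF_inv_DF: "x \<in> \<Omega> \<Longrightarrow> DF x (inv (DF x) w) = w"
  using linear_injective_imp_surjective[OF has_derivative_linear[OF exp_grad_has_derivative] inj_DF]
  by (simp add: surj_f_inv_f)

section \<open>First and second derivatives of the conjugate\<close>

definition "conjugate_grad y = inverse (1 + \<alpha> * (F_inv y \<bullet> y)) *\<^sub>R F_inv y"

lemma cost_arg: "x \<in> \<Omega> \<Longrightarrow> 1 + \<alpha> * (x \<bullet> F x) = inverse (denom x)"
  using denom_pos[of x] by (simp add: exp_grad_eq field_simps) (simp add: denom_def inner_commute)

text \<open>Envelope principle: \<open>conjugate_grad y\<close> is the gradient in \<open>y\<close>
  of \<open>log_cost \<alpha> x y\<close> with the maximiser \<open>x = F_inv y\<close> held
  fixed.\<close>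

lemma exp_conjugate_has_derivative:
  assumes "y \<in> F ` \<Omega>"
  shows "(\<psi> has_derivative (\<lambda>w. w \<bullet> conjugate_grad y)) (at y)"
proof -
  obtain x where x: "x \<in> \<Omega>" and y: "y = F x"
    using assms by blast
  let ?v = "inv (DF x)" and ?p = "denom x"
  note p = denom_pos[OF x]
  have Fx: "F_inv y = x"
    using x y inj_on_exp_grad by simp
  have T: "(F_inv has_derivative ?v) (at y)"
    using F_inv_has_derivative[OF x] y by simp
  have arg: "1 + \<alpha> * (F_inv y \<bullet> y) = inverse ?p"
    using cost_arg[OF x] Fx y by simp
  have "(\<phi> has_derivative (\<lambda>v. v \<bullet> grad \<phi> x)) (at (F_inv y))"
    unfolding Fx using smooth x
    by (intro has_derivative_grad) (auto simp: smooth_on_def dest: spec[of _ "Suc 0"])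
  note \<phi> = has_derivative_compose[OF T this]
  have "((\<lambda>y. 1 + \<alpha> * (F_inv y \<bullet> y)) has_derivative (\<lambda>w. \<alpha> * (x \<bullet> w + ?v w \<bullet> y))) (at y)"
    by (auto intro!: derivative_eq_intros T simp: Fx)
  from has_derivative_ln[OF _ this, unfolded arg]
  have "((\<lambda>y. 1 / \<alpha> * ln (1 + \<alpha> * (F_inv y \<bullet> y)) - \<phi> (F_inv y)) has_derivative
      (\<lambda>w. 1 / \<alpha> * (\<alpha> * (x \<bullet> w + ?v w \<bullet> y) * inverse (inverse ?p)) - ?v w \<bullet> grad \<phi> x)) (at y)"
    using p by (intro has_derivative_diff has_derivative_mult_right \<phi>) simp
  \<comment> \<open>The terms in \<open>?v w\<close> come from the moving maximiser. They cancel
    because \<open>grad \<phi> x\<close> equals \<open>?p *\<^sub>R F x\<close>.\<close>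
  moreover have "1 / \<alpha> * (\<alpha> * (x \<bullet> w + ?v w \<bullet> y) * inverse (inverse ?p)) - ?v w \<bullet> grad \<phi> x
      = w \<bullet> conjugate_grad y" for w
    using alpha_pos unfolding conjugate_grad_def arg unfolding Fx unfolding grad_eq[OF x] y
    by (simp add: inner_commute algebra_simps)
  ultimately show ?thesis
    by (simp add: exp_conjugate_def[abs_def] log_cost_def Let_def)
qed

text \<open>The gradient of \<psi> at \<open>F x\<close> is \<open>denom x *\<^sub>R x\<close>, so
  the rank-one term of \<open>exp_hessian\<close> cancels the part of the derivative containing
  \<open>x \<bullet> w\<close>; what remains depends on \<open>w\<close> only through
  \<open>v w\<close>.\<close>

lemma conjugate_exp_hessian_mult:
  assumes x: "x \<in> \<Omega>"
  defines "v \<equiv> inv (DF x)"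
  shows "exp_hessian \<alpha> \<psi> (F x) *v w = denom x *\<^sub>R (v w - (\<alpha> * (grad \<phi> x \<bullet> v w)) *\<^sub>R x)"
proof -
  let ?y = "F x" and ?p = "denom x"
  note p = denom_pos[OF x]
  have openT: "open (F ` \<Omega>)"
    using diffeomorphism_exp_grad by (simp add: diffeomorphism_def)
  have Fx: "F_inv ?y = x"
    using x inj_on_exp_grad by simp
  have T: "(F_inv has_derivative v) (at ?y)"
    unfolding v_def using F_inv_has_derivative[OF x] .
  have g: "grad \<psi> y = conjugate_grad y" if "y \<in> F ` \<Omega>" for y
    using exp_conjugate_has_derivative[OF that] by (rule grad_eqI)
  have gx: "grad \<psi> ?y = ?p *\<^sub>R x"
    using g[OF imageI[OF x]] cost_arg[OF x] by (simp add: conjugate_grad_def Fx)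
  have "((\<lambda>y. 1 + \<alpha> * (F_inv y \<bullet> y)) has_derivative (\<lambda>w. \<alpha> * (x \<bullet> w + v w \<bullet> ?y))) (at ?y)"
    by (auto intro!: derivative_eq_intros T simp: Fx)
  from has_derivative_scaleR[OF Deriv.has_derivative_inverse[OF _ this] T]
  have "(conjugate_grad has_derivative
      (\<lambda>w. ?p *\<^sub>R v w + - (?p * (\<alpha> * (x \<bullet> w + v w \<bullet> ?y)) * ?p) *\<^sub>R x)) (at ?y)"
    using p cost_arg[OF x] by (simp add: conjugate_grad_def[abs_def] Fx)
  \<comment> \<open>The gradient of \<psi> is identified with \<open>conjugate_grad\<close> only on
    the image of \<open>F\<close>, so its openness carries the derivative over.\<close>
  then have "(grad \<psi> has_derivative
      (\<lambda>w. ?p *\<^sub>R v w + - (?p * (\<alpha> * (x \<bullet> w + v w \<bullet> ?y)) * ?p) *\<^sub>R x)) (at ?y)"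
    by (rule has_derivative_transform_within_open[OF _ openT]) (use x g in auto)
  from exp_hessian_mult[OF this, of \<alpha> w]
  have "exp_hessian \<alpha> \<psi> ?y *v w = ?p *\<^sub>R v w
      + (\<alpha> * (?p * (x \<bullet> w)) * ?p - ?p * (\<alpha> * (x \<bullet> w + v w \<bullet> ?y)) * ?p) *\<^sub>R x"
    by (simp add: gx algebra_simps)
  then show ?thesis
    by (simp add: grad_eq[OF x] inner_commute algebra_simps)
qed

text \<open>The rank-one perturbations in \<open>conjugate_exp_hessian_mult\<close> and
  \<open>exp_hessian_via_DF\<close> are adjoint to each other. Moving one across the inner product
  shows the exponential Hessian of \<psi> as the pullback of \<open>A x\<close> under
  \<open>v\<close>.\<close>

lemma inner_conjugate_exp_hessian:
  assumes x: "x \<in> \<Omega>"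
  defines "v \<equiv> inv (DF x)"
  shows "u \<bullet> (exp_hessian \<alpha> \<psi> (F x) *v w) = (A x *v v u) \<bullet> v w"
proof -
  have "u - (\<alpha> * (x \<bullet> u)) *\<^sub>R grad \<phi> x = inverse (denom x) *\<^sub>R (A x *v v u)"
    using exp_hessian_via_DF[OF x, of "v u"] DF_inv_DF[OF x, of u] by (simp add: v_def)
  then have Av: "A x *v v u = denom x *\<^sub>R (u - (\<alpha> * (x \<bullet> u)) *\<^sub>R grad \<phi> x)"
    using denom_pos[OF x] by simp
  show ?thesis
    unfolding Av unfolding v_def conjugate_exp_hessian_mult[OF x]
    by (simp add: inner_diff_left inner_diff_right inner_commute algebra_simps)
qed

lemma locally_exp_convex_on_exp_conjugate: "locally_exp_convex_on \<alpha> (F ` \<Omega>) \<psi>"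
  unfolding locally_exp_convex_on_def
proof (intro conjI ballI)
  have openT: "open (F ` \<Omega>)"
    and smoothT: "continuously_differentiable_on (Suc 0) F_inv (F ` \<Omega>)"
    using diffeomorphism_exp_grad by (simp_all add: diffeomorphism_def smooth_on_def del: continuously_differentiable_on.simps)
  have "continuously_differentiable_on (Suc 0) conjugate_grad (F ` \<Omega>)"
    unfolding conjugate_grad_def[abs_def]
  proof (intro continuously_differentiable_on_scaleR continuously_differentiable_on_inverse
      continuously_differentiable_on_add continuously_differentiable_on_mult
      continuously_differentiable_on_inner continuously_differentiable_on_const
      continuously_differentiable_on_linear[OF _ bounded_linear_ident] openT smoothT)
    show "1 + \<alpha> * (F_inv y \<bullet> y) \<noteq> 0" if "y \<in> F ` \<Omega>" for y
      using that denom_pos by (force simp: inv_into_f_f[OF inj_on_exp_grad] cost_arg)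
  qed
  from continuously_differentiable_on_Suc_of_gradient[OF openT exp_conjugate_has_derivative this]
  show "continuously_differentiable_on 2 \<psi> (F ` \<Omega>)"
    unfolding numeral_2_eq_2 .
  fix y assume "y \<in> F ` \<Omega>"
  then obtain x where x: "x \<in> \<Omega>" and y: "y = F x"
    by blast
  show "pos_definite (exp_hessian \<alpha> \<psi> y)"
    unfolding y
  proof (rule pos_definiteI)
    show "u \<bullet> (exp_hessian \<alpha> \<psi> (F x) *v w) = (exp_hessian \<alpha> \<psi> (F x) *v u) \<bullet> w" for u w
      using pos_definite_inner_commute[OF exp_hessian_pos[OF x]]
      by (metis inner_conjugate_exp_hessian[OF x] inner_commute)
    show "w \<bullet> (exp_hessian \<alpha> \<psi> (F x) *v w) > 0" if "w \<noteq> 0" for w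
    proof -
      \<comment> \<open>The linear map \<open>DF x\<close> sends this vector to the nonzero
        \<open>w\<close>.\<close>
      have "inv (DF x) w \<noteq> 0"
        using that DF_inv_DF[OF x, of w]
          linear_0[OF has_derivative_linear[OF exp_grad_has_derivative[OF x]]] by auto
      then show ?thesis
        using exp_hessian_pos[OF x]
        by (simp add: inner_conjugate_exp_hessian[OF x] pos_definite_def inner_commute)
    qed
  qed
qed

end

theorem theorem11:
  fixes \<alpha> :: real
    and \<Omega> \<Omega>' :: "(real^'n) set"
    and \<phi> \<psi> :: "real^'n \<Rightarrow> real"
  assumes "\<alpha> > 0"
    and "open \<Omega>" and "convex \<Omega>"
    and "exp_convex_on \<alpha> \<Omega> \<phi>"
    and "smooth_on \<phi> \<Omega>"
    and "\<forall>\<xi>\<in>\<Omega>. pos_definite (exp_hessian \<alpha> \<phi> \<xi>)"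
    and "0 \<in> \<Omega>"
    and "\<forall>\<xi>\<in>\<Omega>. \<forall>\<xi>'\<in>\<Omega>. 1 + \<alpha> * (grad \<phi> \<xi>' \<bullet> (\<xi> - \<xi>')) > 0"
    and "\<Omega>' = exp_grad \<alpha> \<phi> ` \<Omega>"
    and "\<psi> = exp_conjugate \<alpha> \<Omega> \<phi>"
  shows "diffeomorphism \<Omega> \<Omega>' (exp_grad \<alpha> \<phi>) (inv_into \<Omega> (exp_grad \<alpha> \<phi>)) \<and>
    locally_exp_convex_on \<alpha> \<Omega>' \<psi> \<and>
    (\<forall>\<xi>\<in>\<Omega>. is_maximum (\<phi> \<xi>) (\<lambda>\<eta>'. log_cost \<alpha> \<xi> \<eta>' - \<psi> \<eta>') \<Omega>') \<and>
    (\<forall>\<eta>\<in>\<Omega>'. is_maximum (\<psi> \<eta>) (\<lambda>\<xi>'. log_cost \<alpha> \<xi>' \<eta> - \<phi> \<xi>') \<Omega>) \<and>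
    (\<forall>\<xi>\<in>\<Omega>. \<forall>\<xi>'\<in>\<Omega>. \<forall>\<eta>'. \<eta>' = exp_grad \<alpha> \<phi> \<xi>' \<longrightarrow>
      L_divergence \<alpha> \<phi> \<xi> \<xi>' = \<phi> \<xi> + \<psi> \<eta>' - log_cost \<alpha> \<xi> \<eta>')"
proof -
  interpret exp_convex_potential \<alpha> \<Omega> \<phi>
    using assms by unfold_locales auto
  \<comment> \<open>The maximum is attained at \<open>F \<xi>\<close>; in the second formula it is
    attained at the preimage of \<eta>.\<close>
  have "is_maximum (\<phi> \<xi>) (\<lambda>\<eta>'. log_cost \<alpha> \<xi> \<eta>' - \<psi> \<eta>') \<Omega>'" if "\<xi> \<in> \<Omega>" for \<xi>
    using fenchel_young[OF that] exp_conjugate_exp_grad[OF that] that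
    unfolding is_maximum_def assms(9,10) by (force simp: algebra_simps)
  moreover have "is_maximum (\<psi> \<eta>) (\<lambda>\<xi>'. log_cost \<alpha> \<xi>' \<eta> - \<phi> \<xi>') \<Omega>" if "\<eta> \<in> \<Omega>'" for \<eta>
    using fenchel_young exp_conjugate_exp_grad that
    unfolding is_maximum_def assms(9,10) by (force simp: algebra_simps)
  ultimately show ?thesis
    using diffeomorphism_exp_grad locally_exp_convex_on_exp_conjugate L_divergence_self_dual
    unfolding assms(9,10) by blast
qed

end
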